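(* Let $(X,d)$ be a compact metric space and $f_{1,\infty}$ a sequence of continuous self-maps of $X$. Then $(X,f_{1,\infty})$ is weakly mixing of all orders if and only if the induced system $(\mathcal{M}(X),\widetilde{f}_{1,\infty})$ is weakly mixing of all orders.
   Context: For $f_{1,\infty}=\{f_n\}_{n\ge1}$ write $f_1^n=f_n\circ\cdots\circ f_1$. $\mathcal{M}(X)$ is the space of Borel probability measures on $X$ with the weak$^*$ topology, and $\widetilde{f}_1^n(\mu)(A)=\mu((f_1^n)^{-1}(A))$ for Borel $A$. A non-autonomous system $(Y,g_{1,\infty})$ is weakly mixing of order $m$ ($m\ge2$) if for any non-empty open sets $U_1,\dots,U_m,V_1,\dots,V_m\subseteq Y$ there is $n\in\mathbb{N}$ with $g_1^n(U_i)\cap V_i\neq\emptyset$ for all $1\le i\le m$; it is weakly mixing of all orders if this holds for every $m\ge2$. *)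

theory Defs
  imports "HOL-Analysis.Analysis" "HOL-Probability.Probability"
begin

text \<open>Non-autonomous composition: iter_comp f n = f n o ... o f 1 (iter_comp f 0 = id);
  the term f 0 of the sequence is never used (sequences are indexed from 1).\<close>
primrec iter_comp :: "(nat \<Rightarrow> 'b \<Rightarrow> 'b) \<Rightarrow> nat \<Rightarrow> 'b \<Rightarrow> 'b" where
  "iter_comp f 0 = id"
| "iter_comp f (Suc n) = f (Suc n) \<circ> iter_comp f n"

definition weakly_mixing_order :: "'b topology \<Rightarrow> (nat \<Rightarrow> 'b \<Rightarrow> 'b) \<Rightarrow> nat \<Rightarrow> bool" where
  "weakly_mixing_order T g m \<longleftrightarrow>
     (\<forall>U V :: nat \<Rightarrow> 'b set.
        (\<forall>i\<in>{1..m}. openin T (U i) \<and> U i \<noteq> {} \<and> openin T (V i) \<and> V i \<noteq> {}) \<longrightarrow>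
        (\<exists>n\<ge>1. \<forall>i\<in>{1..m}. iter_comp g n ` U i \<inter> V i \<noteq> {}))"

definition weakly_mixing_all_orders :: "'b topology \<Rightarrow> (nat \<Rightarrow> 'b \<Rightarrow> 'b) \<Rightarrow> bool" where
  "weakly_mixing_all_orders T g \<longleftrightarrow> (\<forall>m\<ge>2. weakly_mixing_order T g m)"

definition prob_measures :: "'a::topological_space measure set" where
  "prob_measures = {\<mu>. sets \<mu> = sets borel \<and> prob_space \<mu>}"

definition weak_star_topology :: "'a::topological_space measure topology" where
  "weak_star_topology = topology_generated_by
     {{\<mu> \<in> prob_measures. (\<integral>x. g x \<partial>\<mu>) \<in> U} | g U. continuous_on UNIV g \<and> open (U :: real set)}"

definition induced_map :: "('a::topological_space \<Rightarrow> 'a) \<Rightarrow> 'a measure \<Rightarrow> 'a measure" where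
  "induced_map f \<mu> = distr \<mu> borel f"

end

theory Submission
  imports Defs
begin

text \<open>For the forward direction, cover \<open>X\<close> by finitely many small balls \<open>B\<^sub>i\<close> and choose one time
  \<open>n\<close> and points \<open>z\<^sub>i\<^sub>j \<in> B\<^sub>i\<close> with \<open>f\<^sub>1\<^sup>n(z\<^sub>i\<^sub>j) \<in> B\<^sub>j\<close> for all pairs \<open>i, j\<close>.  With \<open>c\<close> a Borel
  map selecting a ball that contains the given point, the image of \<open>\<mu> \<otimes> \<nu>\<close> under
  \<open>(x, y) \<mapsto> z\<^bsub>c(x) c(y)\<^esub>\<close> is weak* close to \<open>\<mu>\<close>, and its image under \<open>f\<^sub>1\<^sup>n\<close> is weak* close to \<open>\<nu>\<close>.
  The same \<open>n\<close> serves all pairs \<open>\<mu>, \<nu>\<close>.  For the converse, a measure that gives \<open>U\<close> mass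
  more than \<open>1/2\<close> and whose image gives \<open>V\<close> mass more than \<open>1/2\<close> forces
  \<open>U \<inter> (f\<^sub>1\<^sup>n)\<^sup>-\<^sup>1(V) \<noteq> \<emptyset>\<close>.\<close>

section \<open>Weak mixing over finite index sets, and iterates of induced maps\<close>

text \<open>Number \<open>I\<close> by \<open>{1..card I}\<close> and pad both families with the
  whole space. The two padding slots make the order at least 2 even for a small \<open>I\<close>,
  and \<open>topspace T \<noteq> {}\<close> makes the padding admissible. Indexing by pairs of balls
  then becomes possible.\<close>

lemma weakly_mixing_all_orders_finite_family:
  assumes wm: "weakly_mixing_all_orders T g" and "topspace T \<noteq> {}" and "finite I"
    and UV: "\<And>i. i \<in> I \<Longrightarrow> openin T (U i) \<and> U i \<noteq> {} \<and> openin T (V i) \<and> V i \<noteq> {}"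
  shows "\<exists>n\<ge>1. \<forall>i\<in>I. iter_comp g n ` U i \<inter> V i \<noteq> {}"
proof -
  obtain e where e: "bij_betw e {1..card I} I"
    using ex_bij_betw_nat_finite_1[OF \<open>finite I\<close>] by blast
  define U' where "U' k = (if k \<in> {1..card I} then U (e k) else topspace T)" for k
  define V' where "V' k = (if k \<in> {1..card I} then V (e k) else topspace T)" for k
  have eI: "e k \<in> I" if "k \<in> {1..card I}" for k
    using e that by (auto simp: bij_betw_def)
  have wm': "weakly_mixing_order T g (card I + 2)"
    using wm by (simp add: weakly_mixing_all_orders_def)
  have "\<forall>k\<in>{1..card I + 2}. openin T (U' k) \<and> U' k \<noteq> {} \<and> openin T (V' k) \<and> V' k \<noteq> {}"
    using UV eI \<open>topspace T \<noteq> {}\<close> by (simp add: U'_def V'_def)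
  then obtain n where n: "n \<ge> 1" "\<forall>k\<in>{1..card I + 2}. iter_comp g n ` U' k \<inter> V' k \<noteq> {}"
    using wm' unfolding weakly_mixing_order_def by blast
  have "iter_comp g n ` U i \<inter> V i \<noteq> {}" if "i \<in> I" for i
  proof -
    obtain k where k: "k \<in> {1..card I}" "i = e k"
      using e \<open>i \<in> I\<close> unfolding bij_betw_def by blast
    then have "iter_comp g n ` U' k \<inter> V' k \<noteq> {}"
      using n(2) by auto
    then show ?thesis
      using k by (simp add: U'_def V'_def)
  qed
  then show ?thesis
    using n(1) by blast
qed

lemma continuous_on_iter_comp:
  assumes "\<And>n. continuous_on UNIV (f n)"
  shows "continuous_on UNIV (iter_comp f n)"
proof (induction n)
  case (Suc n)
  then show ?case
    using continuous_on_compose[OF Suc continuous_on_subset[OF assms]] by simp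
qed (simp add: id_def)

lemma iter_comp_induced_map:
  assumes f: "\<And>n. continuous_on UNIV (f n)" and "sets \<mu> = sets borel"
  shows "iter_comp (\<lambda>n. induced_map (f n)) n \<mu> = distr \<mu> borel (iter_comp f n)"
proof (induction n)
  \<comment> \<open>At time 0 the claim is that pushing \<open>\<mu>\<close> forward along the
    identity into \<open>borel\<close> returns \<open>\<mu>\<close>, which is where the
    sigma-algebra of \<open>\<mu>\<close> matters.\<close>
  case 0
  then show ?case
    using assms(2) by (simp add: distr_id2 id_def)
next
  case (Suc n)
  have 1: "iter_comp f n \<in> measurable \<mu> borel"
    using borel_measurable_continuous_onI[OF continuous_on_iter_comp[of f, OF f]]
    by (simp add: measurable_cong_sets[OF assms(2) refl])
  have 2: "f (Suc n) \<in> measurable borel borel"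
    using borel_measurable_continuous_onI[OF f] .
  show ?case
    using Suc by (simp add: induced_map_def distr_distr[OF 2 1] o_def)
qed

section \<open>Weak* open sets and perturbation of measures by couplings\<close>

lemma prob_measures_distr:
  assumes "prob_space M" "h \<in> measurable M borel"
  shows "distr M borel h \<in> prob_measures"
  using prob_space.prob_space_distr[OF assms] by (simp add: prob_measures_def)

lemma openin_weak_star_subset:
  assumes "openin weak_star_topology U"
  shows "U \<subseteq> prob_measures"
proof -
  have "U \<subseteq> topspace weak_star_topology"
    using assms by (rule openin_subset)
  also have "\<dots> \<subseteq> prob_measures"
    unfolding weak_star_topology_def topology_generated_by_topspace by blast
  finally show ?thesis .
qed

lemma openin_weak_star_basic:
  fixes g :: "'a::topological_space \<Rightarrow> real"
  assumes "continuous_on UNIV g" "open W"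
  shows "openin weak_star_topology {\<mu> \<in> prob_measures. (\<integral>x. g x \<partial>\<mu>) \<in> W}"
  unfolding weak_star_topology_def using assms by (intro topology_generated_by_Basis) blast

text \<open>A continuous function on a compact space is bounded. The inner map \<open>h\<close> lets
  one statement cover both \<open>g\<close> itself and \<open>g\<close> pulled back along iterates
  or couplings.\<close>

lemma integrable_continuous_compact_UNIV:
  fixes g :: "'a::topological_space \<Rightarrow> real"
  assumes "compact (UNIV :: 'a set)" "continuous_on UNIV g" "prob_space M"
    and h: "h \<in> measurable M borel"
  shows "integrable M (\<lambda>x. g (h x))"
proof -
  interpret prob_space M by fact
  have "bounded (range g)"
    using assms by (intro compact_imp_bounded compact_continuous_image)
  then obtain B where B: "\<And>x. norm (g x) \<le> B"
    by (auto simp: bounded_iff)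
  have "(\<lambda>x. g (h x)) \<in> borel_measurable M"
    using measurable_compose[OF h borel_measurable_continuous_onI[OF assms(2)]] .
  then show ?thesis
    using B by (intro integrable_const_bound[where B = B]) auto
qed

text \<open>The pairs \<open>h, k\<close> are the couplings of \<open>\<mu>\<close> with other measures, so this says that \<open>U\<close>
  contains the \<open>\<infinity>\<close>-Wasserstein ball of radius \<open>\<delta>\<close> around \<open>\<mu>\<close>.\<close>

definition coupling_ball_within :: "'a::metric_space measure \<Rightarrow> 'a measure set \<Rightarrow> real \<Rightarrow> bool" where
  "coupling_ball_within \<mu> U \<delta> \<longleftrightarrow> (\<forall>(M :: ('a \<times> 'a) measure) h k.
    prob_space M \<longrightarrow> h \<in> measurable M borel \<longrightarrow> k \<in> measurable M borel \<longrightarrow>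
    (\<forall>x. dist (h x) (k x) < \<delta>) \<longrightarrow> \<mu> = distr M borel h \<longrightarrow> distr M borel k \<in> U)"

lemma coupling_ball_within_mono:
  assumes "coupling_ball_within \<mu> U \<delta>" "\<delta>' \<le> \<delta>" "U \<subseteq> U'"
  shows "coupling_ball_within \<mu> U' \<delta>'"
  unfolding coupling_ball_within_def
proof (intro allI impI)
  fix M :: "('a \<times> 'a) measure" and h k
  assume *: "prob_space M" "h \<in> measurable M borel" "k \<in> measurable M borel"
    "\<forall>x. dist (h x) (k x) < \<delta>'" "\<mu> = distr M borel h"
  then have "\<forall>x. dist (h x) (k x) < \<delta>"
    using assms(2) order_less_le_trans by blast
  then show "distr M borel k \<in> U'"
    using * assms(1,3) unfolding coupling_ball_within_def by blast
qed

text \<open>Induction on how the topology generates \<open>U\<close>. On a subbasic set the test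
  function \<open>g\<close> is uniformly continuous by compactness, so maps \<open>h\<close> and
  \<open>k\<close> that are everywhere close give close integrals of \<open>g\<close>.\<close>

lemma openin_weak_star_imp_coupling_ball_within:
  fixes U :: "'a::metric_space measure set"
  assumes "compact (UNIV :: 'a set)" "openin weak_star_topology U" "\<mu> \<in> U"
  shows "\<exists>\<delta>>0. coupling_ball_within \<mu> U \<delta>"
proof -
  let ?S = "{{\<mu> \<in> prob_measures. (\<integral>x. g x \<partial>\<mu>) \<in> U} | g U.
    continuous_on (UNIV :: 'a set) g \<and> open (U :: real set)}"
  have "generate_topology_on ?S U"
    using assms(2) by (simp add: weak_star_topology_def openin_topology_generated_by_iff)
  then show ?thesis
    using \<open>\<mu> \<in> U\<close>
  proof (induction rule: generate_topology_on.induct)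
    case Empty
    then show ?case by simp
  next
    case (Int A B)
    then obtain a b where ab: "a > 0" "coupling_ball_within \<mu> A a"
      "b > 0" "coupling_ball_within \<mu> B b"
      by blast
    then have "min a b > 0" "coupling_ball_within \<mu> A (min a b)" "coupling_ball_within \<mu> B (min a b)"
      by (auto intro: coupling_ball_within_mono)
    then show ?case
      unfolding coupling_ball_within_def by blast
  next
    case (UN K)
    then obtain k where "k \<in> K" "\<mu> \<in> k" by blast
    with UN.IH obtain d where "d > 0" "coupling_ball_within \<mu> k d" by blast
    then show ?case
      using \<open>k \<in> K\<close> coupling_ball_within_mono by blast
  next
    case (Basis s)
    then obtain g :: "'a \<Rightarrow> real" and W
      where s: "s = {\<mu> \<in> prob_measures. (\<integral>x. g x \<partial>\<mu>) \<in> W}"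
        and g: "continuous_on UNIV g" and W: "open W" by blast
    have "(\<integral>x. g x \<partial>\<mu>) \<in> W"
      using Basis(2) s by simp
    then obtain e where e: "e > 0" "\<And>r. dist r (\<integral>x. g x \<partial>\<mu>) < e \<Longrightarrow> r \<in> W"
      using W unfolding open_dist by blast
    have "uniformly_continuous_on UNIV g"
      using compact_uniformly_continuous[OF g assms(1)] .
    \<comment> \<open>Integrating the pointwise bound yields only a non-strict inequality;
      \<open>e / 2\<close> leaves room for the strict one.\<close>
    then obtain d where d: "d > 0" "\<And>x y. dist x y < d \<Longrightarrow> dist (g x) (g y) < e / 2"
      unfolding uniformly_continuous_on_def using \<open>e > 0\<close> by (metis UNIV_I half_gt_zero)
    have "distr M borel k \<in> s"
      if M: "prob_space M" and h: "h \<in> measurable M borel" and k: "k \<in> measurable M borel"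
        and dist: "\<And>x. dist (h x) (k x) < d" and \<mu>: "\<mu> = distr M borel h"
      for M :: "('a \<times> 'a) measure" and h k
    proof -
      interpret prob_space M by fact
      have gm: "g \<in> borel_measurable borel"
        using borel_measurable_continuous_onI[OF g] .
      have ih: "integrable M (\<lambda>x. g (h x))" and ik: "integrable M (\<lambda>x. g (k x))"
        using integrable_continuous_compact_UNIV[OF assms(1) g M] h k by auto
      have "\<bar>(\<integral>x. g (k x) \<partial>M) - (\<integral>x. g (h x) \<partial>M)\<bar> = \<bar>\<integral>x. g (k x) - g (h x) \<partial>M\<bar>"
        using ih ik by simp
      also have "\<dots> \<le> (\<integral>x. \<bar>g (k x) - g (h x)\<bar> \<partial>M)"
        by (rule integral_abs_bound)
      also have "\<dots> \<le> (\<integral>x. e / 2 \<partial>M)"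
        using ih ik d(2)[OF dist]
        by (intro integral_mono) (auto simp: dist_real_def abs_minus_commute less_imp_le)
      also have "\<dots> = e / 2"
        by (simp add: prob_space)
      finally have "dist (\<integral>x. g x \<partial>distr M borel k) (\<integral>x. g x \<partial>\<mu>) < e"
        using \<open>e > 0\<close> by (simp add: \<mu> integral_distr[OF h gm] integral_distr[OF k gm] dist_real_def)
      then show ?thesis
        using e(2) prob_measures_distr[OF M k] by (simp add: s)
    qed
    then show ?case
      using \<open>d > 0\<close> unfolding coupling_ball_within_def by blast
  qed
qed

section \<open>From the base system to the induced system\<close>

lemma (in prob_space) distr_pair_snd:
  assumes "sigma_finite_measure N"
  shows "distr (M \<Otimes>\<^sub>M N) N snd = N"
proof (rule measure_eqI)
  interpret N: sigma_finite_measure N by fact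
  fix A assume A: "A \<in> sets (distr (M \<Otimes>\<^sub>M N) N snd)"
  then have "snd -` A \<inter> space (M \<Otimes>\<^sub>M N) = space M \<times> A"
    using sets.sets_into_space[of A N] by (auto simp: space_pair_measure)
  then show "emeasure (distr (M \<Otimes>\<^sub>M N) N snd) A = emeasure N A"
    using A by (simp add: emeasure_distr N.emeasure_pair_measure_Times emeasure_space_1)
qed simp

text \<open>\<open>h\<close> is a Borel right inverse, up to error \<open>\<delta>\<close>, of the
  map sending \<open>z\<close> to \<open>(z, iter_comp f n z)\<close>. Such an \<open>h\<close> can
  take finitely many values, one for each ordered pair of balls in a finite cover.\<close>

lemma weakly_mixing_imp_approximate_section:
  fixes f :: "nat \<Rightarrow> 'a::metric_space \<Rightarrow> 'a"
  assumes "compact (UNIV :: 'a set)" "weakly_mixing_all_orders (euclidean :: 'a topology) f"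
    and "\<delta> > 0"
  obtains n h where "n \<ge> 1" "h \<in> measurable (borel \<Otimes>\<^sub>M borel) (borel :: 'a measure)"
    "\<And>x y. dist x (h (x, y)) < \<delta>" "\<And>x y. dist y (iter_comp f n (h (x, y))) < \<delta>"
proof -
  obtain K :: "'a set" where K: "finite K" "UNIV \<subseteq> (\<Union>x\<in>K. ball x (\<delta> / 2))"
    using compactE_image[OF assms(1), of UNIV "\<lambda>x. ball x (\<delta> / 2)"] \<open>\<delta> > 0\<close>
    by (metis UNIV_I UN_I centre_in_ball half_gt_zero open_ball subsetI)
  then obtain e :: "nat \<Rightarrow> 'a" and N where N: "K = e ` {i. i < N}"
    using finite_imp_nat_seg_image_inj_on by metis
  \<comment> \<open>Taking the least index among the balls containing \<open>x\<close> makes the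
    selection Borel.\<close>
  define c where "c x = (LEAST i. i < N \<and> dist (e i) x < \<delta> / 2)" for x
  have c: "c x < N \<and> dist (e (c x)) x < \<delta> / 2" for x
  proof -
    have "\<exists>i. i < N \<and> dist (e i) x < \<delta> / 2"
    proof -
      have "x \<in> (\<Union>i\<in>{i. i < N}. ball (e i) (\<delta> / 2))"
        using K(2) unfolding N by blast
      then show ?thesis
        by simp
    qed
    then show ?thesis
      unfolding c_def by (rule LeastI_ex)
  qed
  have "{x. i < N \<and> dist (e i) x < \<delta> / 2} \<in> sets borel" for i
  proof -
    have "{x. i < N \<and> dist (e i) x < \<delta> / 2} = (if i < N then ball (e i) (\<delta> / 2) else {})"
      by auto
    then show ?thesis
      by simp
  qed
  then have "Measurable.pred borel (\<lambda>x. i < N \<and> dist (e i) x < \<delta> / 2)" for i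
    unfolding pred_def by (simp only: space_borel UNIV_I simp_thms)
  then have [measurable]: "c \<in> measurable borel (count_space UNIV)"
    unfolding c_def by (rule measurable_Least)
  \<comment> \<open>The index is an ordered pair: \<open>fst p\<close> names the starting ball,
    \<open>snd p\<close> the target ball.\<close>
  have "\<exists>n\<ge>1. \<forall>p\<in>{..<N} \<times> {..<N}.
      iter_comp f n ` ball (e (fst p)) (\<delta> / 2) \<inter> ball (e (snd p)) (\<delta> / 2) \<noteq> {}"
    using assms(2) \<open>\<delta> > 0\<close> by (intro weakly_mixing_all_orders_finite_family) auto
  then obtain n where n: "n \<ge> 1"
    "\<And>i j. i < N \<Longrightarrow> j < N \<Longrightarrow> iter_comp f n ` ball (e i) (\<delta> / 2) \<inter> ball (e j) (\<delta> / 2) \<noteq> {}"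
    by force
  \<comment> \<open>Points for indices outside the range are arbitrary; \<open>c\<close> always
    stays below \<open>N\<close>.\<close>
  have "\<forall>i j. \<exists>z. i < N \<longrightarrow> j < N \<longrightarrow>
      dist (e i) z < \<delta> / 2 \<and> dist (e j) (iter_comp f n z) < \<delta> / 2"
    using n(2) by fastforce
  then obtain z where z: "\<And>i j. i < N \<Longrightarrow> j < N \<Longrightarrow>
      dist (e i) (z i j) < \<delta> / 2 \<and> dist (e j) (iter_comp f n (z i j)) < \<delta> / 2"
    by metis
  \<comment> \<open>\<open>h\<close> is measurable because it factors through two indices in a
    countable discrete space.\<close>
  define h where "h p = z (c (fst p)) (c (snd p))" for p
  have "h \<in> measurable (borel \<Otimes>\<^sub>M borel) borel"
    unfolding h_def by measurable
  moreover have "dist x (h (x, y)) < \<delta>" "dist y (iter_comp f n (h (x, y))) < \<delta>" for x y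
    using z[of "c x" "c y"] c[of x] c[of y] unfolding h_def
    by (auto intro: dist_triangle_half_r)
  ultimately show thesis
    using that n(1) by blast
qed

lemma weakly_mixing_imp_induced_weakly_mixing:
  fixes f :: "nat \<Rightarrow> 'a::metric_space \<Rightarrow> 'a"
  assumes cpt: "compact (UNIV :: 'a set)" and f: "\<And>n. continuous_on UNIV (f n)"
    and wm: "weakly_mixing_all_orders (euclidean :: 'a topology) f"
  shows "weakly_mixing_all_orders weak_star_topology (\<lambda>n. induced_map (f n))"
  unfolding weakly_mixing_all_orders_def weakly_mixing_order_def
proof (intro allI impI)
  fix m :: nat and U V :: "nat \<Rightarrow> 'a measure set"
  assume UV: "\<forall>i\<in>{1..m}. openin weak_star_topology (U i) \<and> U i \<noteq> {} \<and>
    openin weak_star_topology (V i) \<and> V i \<noteq> {}"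
  have "\<forall>i. \<exists>\<mu> \<nu>. i \<in> {1..m} \<longrightarrow> \<mu> \<in> U i \<and> \<nu> \<in> V i"
    using UV by blast
  then obtain \<mu> \<nu> where \<mu>\<nu>: "\<And>i. i \<in> {1..m} \<Longrightarrow> \<mu> i \<in> U i \<and> \<nu> i \<in> V i"
    by metis
  let ?P = "coupling_ball_within :: 'a measure \<Rightarrow> _"
  have "\<forall>i. \<exists>\<delta>>0. i \<in> {1..m} \<longrightarrow> ?P (\<mu> i) (U i) \<delta> \<and> ?P (\<nu> i) (V i) \<delta>"
  proof
    fix i
    show "\<exists>\<delta>>0. i \<in> {1..m} \<longrightarrow> ?P (\<mu> i) (U i) \<delta> \<and> ?P (\<nu> i) (V i) \<delta>"
    proof (cases "i \<in> {1..m}")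
      case True
      obtain a b where "a > 0" "?P (\<mu> i) (U i) a" "b > 0" "?P (\<nu> i) (V i) b"
        using openin_weak_star_imp_coupling_ball_within[OF cpt] UV \<mu>\<nu> True by meson
      then show ?thesis
        by (intro exI[of _ "min a b"]) (auto intro: coupling_ball_within_mono)
    qed (auto intro: exI[of _ 1])
  qed
  then obtain d where d: "\<And>i. d i > 0"
    "\<And>i. i \<in> {1..m} \<Longrightarrow> ?P (\<mu> i) (U i) (d i) \<and> ?P (\<nu> i) (V i) (d i)"
    by metis
  \<comment> \<open>The inserted \<open>1\<close> keeps the argument of \<open>Min\<close> non-empty
    whatever \<open>m\<close> is.\<close>
  define \<delta> where "\<delta> = Min (insert 1 (d ` {1..m}))"
  have "\<delta> > 0"
    unfolding \<delta>_def using d(1) by (subst Min_gr_iff) auto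
  have \<delta>: "?P (\<mu> i) (U i) \<delta> \<and> ?P (\<nu> i) (V i) \<delta>" if "i \<in> {1..m}" for i
  proof -
    have "\<delta> \<le> d i"
      unfolding \<delta>_def using that by (intro Min_le) auto
    then show ?thesis
      using d(2)[OF that] coupling_ball_within_mono by blast
  qed
  \<comment> \<open>Only the common radius \<open>\<delta>\<close> enters here, so \<open>n\<close>
    and \<open>h\<close> are fixed before the index \<open>i\<close>.\<close>
  obtain n h where n: "n \<ge> 1" and h: "h \<in> measurable (borel \<Otimes>\<^sub>M borel) (borel :: 'a measure)"
    and hd: "\<And>x y. dist x (h (x, y)) < \<delta>" "\<And>x y. dist y (iter_comp f n (h (x, y))) < \<delta>"
    using weakly_mixing_imp_approximate_section[OF cpt wm \<open>\<delta> > 0\<close>] by blast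
  have F: "iter_comp f n \<in> measurable borel borel"
    using borel_measurable_continuous_onI[OF continuous_on_iter_comp[of f, OF f]] .
  have "iter_comp (\<lambda>n. induced_map (f n)) n ` U i \<inter> V i \<noteq> {}" if i: "i \<in> {1..m}" for i
  proof -
    have "\<mu> i \<in> prob_measures" "\<nu> i \<in> prob_measures"
      using openin_weak_star_subset UV \<mu>\<nu> i by blast+
    then have s: "sets (\<mu> i) = sets borel" "sets (\<nu> i) = sets borel"
      and p: "prob_space (\<mu> i)" "prob_space (\<nu> i)"
      by (auto simp: prob_measures_def)
    interpret \<mu>: prob_space "\<mu> i" by fact
    interpret \<nu>: prob_space "\<nu> i" by fact
    interpret \<mu>\<nu>: pair_prob_space "\<mu> i" "\<nu> i" ..
    let ?M = "\<mu> i \<Otimes>\<^sub>M \<nu> i"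
    have sM: "sets ?M = sets (borel \<Otimes>\<^sub>M borel)"
      using s by (rule sets_pair_measure_cong)
    have M: "prob_space ?M"
      by (rule \<mu>\<nu>.prob_space_axioms)
    have hM: "h \<in> measurable ?M borel" and fstM: "fst \<in> measurable ?M borel"
      and sndM: "snd \<in> measurable ?M borel"
      using h by (simp_all add: measurable_cong_sets[OF sM refl])
    have FhM: "iter_comp f n \<circ> h \<in> measurable ?M borel"
      using measurable_comp[OF hM F] .
    \<comment> \<open>Under the product measure, \<open>fst\<close> and \<open>h\<close> couple
      \<open>\<mu> i\<close> with a measure in \<open>U i\<close>, while \<open>snd\<close> and
      \<open>iter_comp f n \<circ> h\<close> couple \<open>\<nu> i\<close> with the image of that
      measure.\<close>
    have "distr ?M borel fst = distr ?M (\<mu> i) fst"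
      using s by (intro distr_cong) auto
    then have 1: "\<mu> i = distr ?M borel fst"
      using \<nu>.distr_pair_fst[of "\<mu> i"] by simp
    have "distr ?M borel snd = distr ?M (\<nu> i) snd"
      using s by (intro distr_cong) auto
    then have 2: "\<nu> i = distr ?M borel snd"
      using \<mu>.distr_pair_snd[of "\<nu> i"] \<nu>.sigma_finite_measure_axioms by simp
    have U: "distr ?M borel h \<in> U i"
    proof -
      have "dist (fst p) (h p) < \<delta>" for p
        using hd(1)[of "fst p" "snd p"] by simp
      then show ?thesis
        using \<delta>[OF i] M hM fstM 1 unfolding coupling_ball_within_def by blast
    qed
    have V: "distr ?M borel (iter_comp f n \<circ> h) \<in> V i"
    proof -
      have "dist (snd p) ((iter_comp f n \<circ> h) p) < \<delta>" for p
        using hd(2)[of "snd p" "fst p"] by simp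
      then show ?thesis
        using \<delta>[OF i] M FhM sndM 2 unfolding coupling_ball_within_def by blast
    qed
    have "iter_comp (\<lambda>n. induced_map (f n)) n (distr ?M borel h)
        = distr ?M borel (iter_comp f n \<circ> h)"
      using iter_comp_induced_map[of f "distr ?M borel h" n, OF f sets_distr]
      unfolding distr_distr[OF F hM] .
    then have "distr ?M borel (iter_comp f n \<circ> h) \<in> iter_comp (\<lambda>n. induced_map (f n)) n ` U i"
      using U by (rule image_eqI[OF sym])
    then show ?thesis
      using V by blast
  qed
  then show "\<exists>n\<ge>1. \<forall>i\<in>{1..m}. iter_comp (\<lambda>n. induced_map (f n)) n ` U i \<inter> V i \<noteq> {}"
    using n by blast
qed

section \<open>From the induced system back to the base system\<close>

text \<open>A tent function of the distance to \<open>x\<close>. It serves as a continuous minorant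
  of the indicator of \<open>U\<close>, since weak* open sets are tested by continuous
  functions.\<close>

lemma bump_function:
  fixes U :: "'a::metric_space set"
  assumes "open U" "x \<in> U"
  obtains g :: "'a \<Rightarrow> real" where "continuous_on UNIV g" "g x = 1"
    "\<And>y. 0 \<le> g y" "\<And>y. g y \<le> 1" "\<And>y. y \<notin> U \<Longrightarrow> g y = 0"
proof -
  obtain r where r: "r > 0" "ball x r \<subseteq> U"
    using assms open_contains_ball by blast
  have "max 0 (1 - dist x y / r) = 0" if "y \<notin> U" for y
  proof -
    have "r \<le> dist x y"
      using r(2) that by (meson in_mono mem_ball not_le_imp_less)
    then show ?thesis
      using r(1) by (simp add: field_simps)
  qed
  then show thesis
    using r(1)
    by (intro that[of "\<lambda>y. max 0 (1 - dist x y / r)"]) (auto intro!: continuous_intros)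
qed

lemma induced_weakly_mixing_imp_weakly_mixing:
  fixes f :: "nat \<Rightarrow> 'a::metric_space \<Rightarrow> 'a"
  assumes cpt: "compact (UNIV :: 'a set)" and f: "\<And>n. continuous_on UNIV (f n)"
    and wm: "weakly_mixing_all_orders weak_star_topology (\<lambda>n. induced_map (f n))"
  shows "weakly_mixing_all_orders (euclidean :: 'a topology) f"
  unfolding weakly_mixing_all_orders_def weakly_mixing_order_def
proof (intro allI impI)
  fix m :: nat and U V :: "nat \<Rightarrow> 'a set"
  assume "m \<ge> 2"
    and UV: "\<forall>i\<in>{1..m}. openin euclidean (U i) \<and> U i \<noteq> {} \<and> openin euclidean (V i) \<and> V i \<noteq> {}"
  define bump where "bump W g \<longleftrightarrow> continuous_on UNIV g \<and> (\<exists>x. g x = 1) \<and>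
    (\<forall>y. 0 \<le> g y \<and> g y \<le> 1 \<and> (y \<notin> W \<longrightarrow> g y = 0))" for W :: "'a set" and g :: "'a \<Rightarrow> real"
  have "\<exists>g. bump W g" if "open W" "W \<noteq> {}" for W
    using that bump_function unfolding bump_def by (metis ex_in_conv)
  then have "\<forall>i. \<exists>g k. i \<in> {1..m} \<longrightarrow> bump (U i) g \<and> bump (V i) k"
    using UV by (metis open_openin)
  then obtain g k where gk: "\<And>i. i \<in> {1..m} \<Longrightarrow> bump (U i) (g i) \<and> bump (V i) (k i)"
    by metis
  \<comment> \<open>For a bump below the indicator of \<open>W\<close>, an integral above
    \<open>1/2\<close> forces mass above \<open>1/2\<close> on \<open>W\<close>, and this condition
    is weak* open.\<close>
  define big where "big g = {\<mu> \<in> prob_measures. (\<integral>x. g x \<partial>\<mu>) \<in> {1/2 <..}}"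
    for g :: "'a \<Rightarrow> real"
  have big: "openin weak_star_topology (big g) \<and> big g \<noteq> {}" if bump: "bump W g" for W g
  proof
    have g: "continuous_on UNIV g"
      using bump by (simp add: bump_def)
    then show "openin weak_star_topology (big g)"
      unfolding big_def by (intro openin_weak_star_basic) auto
    obtain x where "g x = 1"
      using bump by (auto simp: bump_def)
    \<comment> \<open>The Dirac measure at a peak of \<open>g\<close> has integral 1.\<close>
    then have "return borel x \<in> big g"
      using borel_measurable_continuous_onI[OF g]
      by (simp add: big_def prob_measures_def prob_space_return integral_return)
    then show "big g \<noteq> {}" by blast
  qed
  obtain n where n: "n \<ge> 1"
    "\<forall>i\<in>{1..m}. iter_comp (\<lambda>n. induced_map (f n)) n ` big (g i) \<inter> big (k i) \<noteq> {}"
  proof -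
    have "\<forall>i\<in>{1..m}. openin weak_star_topology (big (g i)) \<and> big (g i) \<noteq> {} \<and>
        openin weak_star_topology (big (k i)) \<and> big (k i) \<noteq> {}"
      using gk big by blast
    moreover have "weakly_mixing_order weak_star_topology (\<lambda>n. induced_map (f n)) m"
      using wm \<open>m \<ge> 2\<close> by (simp add: weakly_mixing_all_orders_def)
    ultimately have "\<exists>n\<ge>1. \<forall>i\<in>{1..m}.
        iter_comp (\<lambda>n. induced_map (f n)) n ` big (g i) \<inter> big (k i) \<noteq> {}"
      unfolding weakly_mixing_order_def
      by (elim allE[of _ "\<lambda>i. big (g i)"] allE[of _ "\<lambda>i. big (k i)"] impE) assumption+
    then show thesis
      using that by blast
  qed
  have "iter_comp f n ` U i \<inter> V i \<noteq> {}" if i: "i \<in> {1..m}" for i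
  proof
    assume disj: "iter_comp f n ` U i \<inter> V i = {}"
    obtain \<mu> where \<mu>: "\<mu> \<in> big (g i)" "iter_comp (\<lambda>n. induced_map (f n)) n \<mu> \<in> big (k i)"
      using n(2) i by blast
    then have s: "sets \<mu> = sets borel" and p: "prob_space \<mu>"
      by (auto simp: big_def prob_measures_def)
    interpret prob_space \<mu> by fact
    have F: "iter_comp f n \<in> measurable \<mu> borel"
      using borel_measurable_continuous_onI[OF continuous_on_iter_comp[of f, OF f]]
      by (simp add: measurable_cong_sets[OF s refl])
    have id: "(\<lambda>x. x) \<in> measurable \<mu> borel"
      by (simp add: measurable_cong_sets[OF s refl])
    have g: "continuous_on UNIV (g i)" and k: "continuous_on UNIV (k i)"
      using gk[OF i] by (auto simp: bump_def)
    have ig: "integrable \<mu> (g i)"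
      using integrable_continuous_compact_UNIV[OF cpt g p id] by simp
    have ik: "integrable \<mu> (\<lambda>x. k i (iter_comp f n x))"
      using integrable_continuous_compact_UNIV[OF cpt k p F] .
    have "1/2 < (\<integral>x. g i x \<partial>\<mu>)" "1/2 < (\<integral>x. k i (iter_comp f n x) \<partial>\<mu>)"
      using \<mu> by (auto simp: big_def iter_comp_induced_map[of f, OF f s]
          integral_distr[OF F borel_measurable_continuous_onI[OF k]])
    then have "1 < (\<integral>x. g i x + k i (iter_comp f n x) \<partial>\<mu>)"
      using ig ik by simp
    \<comment> \<open>By disjointness at most one of the two bumps is non-zero at each
      \<open>x\<close>, so their sum is at most 1 pointwise, against an integral above 1.\<close>
    also have "\<dots> \<le> (\<integral>x. 1 \<partial>\<mu>)"
    proof (intro integral_mono)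
      fix x
      have "x \<notin> U i \<or> iter_comp f n x \<notin> V i"
        using disj by blast
      then show "g i x + k i (iter_comp f n x) \<le> 1"
      proof
        assume "x \<notin> U i"
        then have "g i x = 0"
          using gk[OF i] by (simp add: bump_def)
        then show ?thesis
          using gk[OF i] by (simp add: bump_def)
      next
        assume "iter_comp f n x \<notin> V i"
        then have "k i (iter_comp f n x) = 0"
          using gk[OF i] by (simp add: bump_def)
        then show ?thesis
          using gk[OF i] by (simp add: bump_def)
      qed
    qed (use ig ik in auto)
    finally show False
      by (simp add: prob_space)
  qed
  then show "\<exists>n\<ge>1. \<forall>i\<in>{1..m}. iter_comp f n ` U i \<inter> V i \<noteq> {}"
    using n(1) by blast
qed

theorem theorem3p5:
  fixes f :: "nat \<Rightarrow> 'a::metric_space \<Rightarrow> 'a"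
  assumes "compact (UNIV :: 'a set)"
    and "\<And>n. continuous_on UNIV (f n)"
  shows "weakly_mixing_all_orders (euclidean :: 'a topology) f \<longleftrightarrow>
         weakly_mixing_all_orders weak_star_topology (\<lambda>n. induced_map (f n))"
proof
  show "weakly_mixing_all_orders weak_star_topology (\<lambda>n. induced_map (f n))"
    if "weakly_mixing_all_orders (euclidean :: 'a topology) f"
    using assms that by (rule weakly_mixing_imp_induced_weakly_mixing)
  show "weakly_mixing_all_orders (euclidean :: 'a topology) f"
    if "weakly_mixing_all_orders weak_star_topology (\<lambda>n. induced_map (f n))"
    using assms that by (rule induced_weakly_mixing_imp_weakly_mixing)
qed

end
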